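(* Let $d \geq 2$ be an integer. Suppose $\lambda = r e^{\iota\varphi}$ where $\varphi \in [\pi/2, \pi)$ and $$ r < \frac{\sin(\varphi/d)\,\sin^d(\varphi)}{\sin\big((d-1)\varphi/d - d\psi^*\big)\,\sin^d(\varphi - \psi^* )}, $$ where $\psi^* = \max\left( \frac{1}{d+1}\left( (2 - 1/d)\varphi - \pi\right), 0 \right)$. Then $Z_G(\lambda) \neq 0$ for every graph $G$ of maximum degree at most $d+1$.
   Context: For a finite graph $G$, $Z_G(\lambda) = \sum_{I} \lambda^{|I|}$, the sum over all independent sets $I$ of $G$ (including the empty set); $\iota$ denotes the imaginary unit and $r \geq 0$. *)

theory Defs
  imports "HOL-Analysis.Analysis" "Graph_Theory.Digraph"
begin

text \<open>
  Finite simple undirected graphs are rendered by the locale \<open>graph\<close>: finite digraphs without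
  loops and parallel arcs whose adjacency relation is symmetric. An undirected edge is
  a pair of opposite arcs, so the degree of a vertex is its out-degree.
\<close>

text \<open>Inserting \<open>0\<close> only matters for the graph without vertices, whose maximum degree is taken
  to be \<open>0\<close>.\<close>

definition max_degree :: "('a, 'b) pre_digraph \<Rightarrow> nat" where
  "max_degree G = Max (insert 0 (out_degree G ` verts G))"

definition independent_set :: "('a, 'b) pre_digraph \<Rightarrow> 'a set \<Rightarrow> bool" where
  "independent_set G I \<longleftrightarrow> I \<subseteq> verts G \<and> (\<forall>u\<in>I. \<forall>v\<in>I. \<not> u \<rightarrow>\<^bsub>G\<^esub> v)"

definition independence_poly :: "('a, 'b) pre_digraph \<Rightarrow> complex \<Rightarrow> complex" where
  "independence_poly G z = (\<Sum>I | independent_set G I. z ^ card I)"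

definition psi_star :: "nat \<Rightarrow> real \<Rightarrow> real" where
  "psi_star d \<phi> = max (1 / (real d + 1) * ((2 - 1 / real d) * \<phi> - pi)) 0"

end

theory Submission
  imports Defs
begin

text \<open>
  For a vertex \<open>v\<close> with neighbours \<open>u\<^sub>1, \<dots>, u\<^sub>n\<close> in \<open>S\<close> the ratio \<open>R = \<lambda> Z(S - N(v)) / Z(S)\<close>
  satisfies \<open>R = \<lambda> / \<Prod>\<^sub>i (1 + R\<^sub>i)\<close>, where \<open>R\<^sub>i\<close> is the ratio of \<open>u\<^sub>i\<close> in a smaller set in which
  it has at most \<open>d\<close> neighbours. The region of all \<open>R\<close> with \<open>arg R \<in> [0, \<phi>]\<close> and
  \<open>arg (1 + R) \<in> [0, \<phi>/d]\<close> is preserved by this recursion when \<open>n \<le> d\<close>: if \<open>arg (1 + R\<^sub>i) = \<alpha>\<^sub>i\<close>,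
  then \<open>arg R = \<phi> - \<Sum>\<alpha>\<^sub>i \<in> [0, \<phi>]\<close>, and \<open>\<bar>R\<bar> \<le> r \<Prod>\<^sub>i sin (\<phi> - \<alpha>\<^sub>i) / sin \<phi>\<close> by the law of sines, so
  \<open>arg (1 + R) \<le> \<phi>/d\<close> amounts to an upper bound for
  \<open>sin ((d-1)\<phi>/d - \<Sum>\<alpha>\<^sub>i) \<Prod>\<^sub>i sin (\<phi> - \<alpha>\<^sub>i)\<close>. By concavity of \<open>ln \<circ> sin\<close> this product is largest when all
  \<open>\<alpha>\<^sub>i\<close> equal \<open>\<psi>\<^sup>*\<close>. At a vertex with \<open>d + 1\<close> neighbours \<open>arg R \<in> [-\<phi>/d, \<phi>]\<close>, hence still \<open>R \<noteq> -1\<close>.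
\<close>

section \<open>Trigonometric inequalities\<close>

text \<open>The function \<open>ln \<circ> sin\<close> is concave on the open interval from
  \<open>0\<close> to \<open>pi\<close>, with derivative \<open>cot\<close>. This is its tangent
  inequality at \<open>x\<close>, exponentiated.\<close>

lemma sin_le_sin_exp_cot:
  fixes x y :: real
  assumes "0 < x" "x < pi" "0 < y" "y < pi"
  shows "sin y \<le> sin x * exp ((y - x) * cot x)"
proof -
  have pos: "sin t > 0" if "t \<in> {0<..<pi}" for t :: real
    using that by (simp add: sin_gt_zero)
  have "- cot x * (y - x) \<le> - ln (sin y) - (- ln (sin x))"
  proof (rule f''_imp_f'[where C = "{0<..<pi}" and f = "\<lambda>t. - ln (sin t)"
        and f' = "\<lambda>t. - cot t" and f'' = "\<lambda>t. inverse (sin t ^ 2)"])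
    fix t :: real
    assume t: "t \<in> {0<..<pi}"
    show "((\<lambda>t. - ln (sin t)) has_real_derivative - cot t) (at t)"
      using pos[OF t] by (auto intro!: derivative_eq_intros simp: cot_def)
    show "((\<lambda>t. - cot t) has_real_derivative inverse (sin t ^ 2)) (at t)"
      using pos[OF t] DERIV_minus[OF DERIV_cot[of t]] by simp
    show "inverse (sin t ^ 2) \<ge> 0"
      by simp
  qed (use assms in auto)
  then have "ln (sin y) \<le> ln (sin x) + (y - x) * cot x"
    by (simp add: algebra_simps)
  then have "exp (ln (sin y)) \<le> exp (ln (sin x) + (y - x) * cot x)"
    by simp
  with pos[of x] pos[of y] assms show ?thesis
    by (simp add: exp_add)
qed

lemma cot_add_cot:
  fixes x y :: real
  assumes "sin x \<noteq> 0" "sin y \<noteq> 0"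
  shows "cot x + cot y = sin (x + y) / (sin x * sin y)"
  using assms by (simp add: cot_def sin_add field_simps)

lemma prod_rcis: "(\<Prod>u\<in>N. rcis (\<rho> u) (\<alpha> u)) = rcis (prod \<rho> N) (sum \<alpha> N)" if "finite N"
  using that by (induction N rule: finite_induct) (simp_all add: rcis_mult)

context
  fixes d :: nat and \<phi> :: real
  assumes d: "d \<ge> 2" and \<phi>: "0 < \<phi>" "\<phi> < pi"
begin

text \<open>\<open>A\<close> and \<open>B\<close> are the angles in the denominator of the bound on
  \<open>r\<close>. Since \<open>A + B = (2 - 1/d) * \<phi> - (d + 1) * \<psi>\<close> for \<psi> =
  \<open>psi_star d \<phi>\<close>, this \<psi> is the least nonnegative value for which
  \<open>A + B\<close> does not exceed \<open>pi\<close>.\<close>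

lemma psi_star_angles:
  defines "A \<equiv> (real d - 1) * \<phi> / real d - real d * psi_star d \<phi>" and "B \<equiv> \<phi> - psi_star d \<phi>"
  shows "psi_star d \<phi> \<ge> 0" "0 < A" "A < pi" "0 < B" "B < pi" "A + B \<le> pi"
    "psi_star d \<phi> > 0 \<Longrightarrow> A + B = pi"
proof -
  define \<psi> where "\<psi> = psi_star d \<phi>"
  show nonneg: "psi_star d \<phi> \<ge> 0"
    by (simp add: psi_star_def)
  have AB: "A + B = (2 - 1 / d) * \<phi> - (d + 1) * \<psi>"
    using d unfolding A_def B_def \<psi>_def[symmetric] by (simp add: field_simps)
  have "(2 - 1 / d) * \<phi> - pi \<le> (d + 1) * \<psi>"
  proof -
    have "1 / (real d + 1) * ((2 - 1 / d) * \<phi> - pi) \<le> \<psi>"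
      unfolding \<psi>_def psi_star_def by (rule max.cobounded1)
    then have "((2 - 1 / d) * \<phi> - pi) / (real d + 1) \<le> \<psi>"
      by simp
    moreover have "real d + 1 > 0"
      by simp
    ultimately show ?thesis
      by (simp only: pos_divide_le_eq mult.commute of_nat_add of_nat_1)
  qed
  with AB show le: "A + B \<le> pi"
    by simp
  have eq: "A + B = pi" if "\<psi> > 0"
  proof -
    have "\<psi> = 1 / (real d + 1) * ((2 - 1 / real d) * \<phi> - pi)"
      using that unfolding \<psi>_def psi_star_def by (simp add: max_def split: if_splits)
    then have "(real d + 1) * \<psi> = (2 - 1 / real d) * \<phi> - pi"
      by (simp add: field_simps)
    with AB show ?thesis
      by (simp add: add.commute)
  qed
  then show "psi_star d \<phi> > 0 \<Longrightarrow> A + B = pi"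
    by (simp add: \<psi>_def)
  \<comment> \<open>If \<psi> is positive, then \<open>A + B = pi\<close>. Hence
    \<open>B < pi\<close> makes \<open>A\<close> positive, and \<open>A < \<phi> < pi\<close> makes
    \<open>B\<close> positive.\<close>
  have "A > 0 \<and> B > 0"
  proof (cases "\<psi> = 0")
    case True
    with d \<phi> show ?thesis
      by (simp add: A_def B_def \<psi>_def)
  next
    case False
    with nonneg have pos: "\<psi> > 0"
      by (simp add: \<psi>_def)
    have "B < pi"
      using \<phi> pos by (simp add: B_def \<psi>_def)
    with eq[OF pos] have "A > 0"
      by simp
    moreover have "A < \<phi>"
    proof -
      have "(real d - 1) * \<phi> / real d < \<phi>"
        using d \<phi> by (simp add: field_simps)
      with nonneg d show ?thesis
        unfolding A_def by (smt (verit) mult_nonneg_nonneg of_nat_0_le_iff)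
    qed
    ultimately show ?thesis
      using eq[OF pos] \<phi> by simp
  qed
  with le show "0 < A" "A < pi" "0 < B" "B < pi"
    by auto
qed

text \<open>Each factor is bounded by its tangent inequality, at \<open>A\<close> for the first sine
  and at \<open>B\<close> for the others. Missing neighbours count as neighbours with angle
  \<open>0\<close>, so there are always \<open>d\<close> factors of the second kind. The exponents
  then add up to \<open>(d * \<psi> - sum \<alpha> N) * (cot A + cot B)\<close>, which is not
  positive.\<close>

lemma sin_mult_prod_sin_le:
  fixes \<alpha> :: "'a \<Rightarrow> real"
  defines "A \<equiv> (real d - 1) * \<phi> / real d - real d * psi_star d \<phi>" and "B \<equiv> \<phi> - psi_star d \<phi>"
  assumes N: "card N \<le> d"
    and \<alpha>: "\<And>u. u \<in> N \<Longrightarrow> 0 \<le> \<alpha> u \<and> \<alpha> u < \<phi>"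
    and pos: "sum \<alpha> N < \<phi> - \<phi> / d"
  shows "sin (\<phi> - sum \<alpha> N - \<phi> / d) * ((\<Prod>u\<in>N. sin (\<phi> - \<alpha> u)) * sin \<phi> ^ (d - card N))
    \<le> sin A * sin B ^ d"
proof -
  define \<psi> where "\<psi> = psi_star d \<phi>"
  note ang = psi_star_angles[folded A_def B_def \<psi>_def]
  have sA: "sin A > 0" and sB: "sin B > 0"
    using ang by (simp_all add: sin_gt_zero)
  have sum_nonneg: "sum \<alpha> N \<ge> 0"
    using \<alpha> by (simp add: sum_nonneg)
  have \<phi>d: "\<phi> / d > 0"
    using d \<phi> by simp
  have A: "\<phi> - sum \<alpha> N - \<phi> / d - A = d * \<psi> - sum \<alpha> N"
    using d by (simp add: A_def \<psi>_def field_simps)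
  have "sin (\<phi> - sum \<alpha> N - \<phi> / d) \<le> sin A * exp ((\<phi> - sum \<alpha> N - \<phi> / d - A) * cot A)"
    by (rule sin_le_sin_exp_cot) (use ang pos \<phi>d \<phi> sum_nonneg in linarith)+
  then have 1: "sin (\<phi> - sum \<alpha> N - \<phi> / d) \<le> sin A * exp ((d * \<psi> - sum \<alpha> N) * cot A)"
    by (simp only: A)
  have tangent: "sin (\<phi> - a) \<le> sin B * exp ((\<psi> - a) * cot B)" if "0 \<le> a" "a < \<phi>" for a
    using sin_le_sin_exp_cot[of B "\<phi> - a"] that ang \<phi> by (simp add: B_def \<psi>_def)
  have nonneg: "sin (\<phi> - a) \<ge> 0" if "0 \<le> a" "a < \<phi>" for a
    using that \<phi> by (simp add: sin_ge_zero)
  have "(\<Prod>u\<in>N. sin (\<phi> - \<alpha> u)) \<le> (\<Prod>u\<in>N. sin B * exp ((\<psi> - \<alpha> u) * cot B))"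
    using \<alpha> tangent nonneg by (intro prod_mono) auto
  also have "\<dots> = sin B ^ card N * exp ((card N * \<psi> - sum \<alpha> N) * cot B)"
  \<comment> \<open>For infinite \<open>N\<close> the cardinality and the sum default to
    \<open>0\<close> and the product to \<open>1\<close>, so both sides are
    \<open>1\<close>.\<close>
  proof (cases "finite N")
    case True
    then show ?thesis
      by (simp add: prod.distrib exp_sum[symmetric] sum_distrib_right[symmetric] sum_subtractf)
  qed simp
  finally have 2: "(\<Prod>u\<in>N. sin (\<phi> - \<alpha> u)) \<le> sin B ^ card N * exp ((card N * \<psi> - sum \<alpha> N) * cot B)" .
  have "sin \<phi> ^ (d - card N) \<le> (sin B * exp (\<psi> * cot B)) ^ (d - card N)"
    using tangent[of 0] nonneg[of 0] \<phi> by (intro power_mono) auto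
  also have "\<dots> = sin B ^ (d - card N) * exp ((d - card N) * \<psi> * cot B)"
    by (simp add: power_mult_distrib exp_of_nat_mult[symmetric] mult.assoc)
  finally have 3: "sin \<phi> ^ (d - card N) \<le> sin B ^ (d - card N) * exp ((d - card N) * \<psi> * cot B)" .
  \<comment> \<open>If \<psi> is \<open>0\<close>, the first factor is not positive, and the second
    is not negative because \<open>A + B\<close> is at most \<open>pi\<close>. Otherwise
    \<open>A + B = pi\<close> and the second factor vanishes.\<close>
  have "(d * \<psi> - sum \<alpha> N) * (cot A + cot B) \<le> 0"
  proof (cases "\<psi> = 0")
    case True
    have "sin (A + B) \<ge> 0"
      using ang by (intro sin_ge_zero) auto
    then have "cot A + cot B \<ge> 0"
      using sA sB by (simp add: cot_add_cot)
    with True sum_nonneg show ?thesis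
      by (simp add: mult_nonneg_nonneg)
  next
    case False
    with ang have "A + B = pi"
      by simp
    then show ?thesis
      using sA sB by (simp add: cot_add_cot)
  qed
  then have exponent: "(d * \<psi> - sum \<alpha> N) * cot A
      + ((card N * \<psi> - sum \<alpha> N) * cot B + (d - card N) * \<psi> * cot B) \<le> 0"
    using N by (simp add: of_nat_diff algebra_simps)
  have "sin (\<phi> - sum \<alpha> N - \<phi> / d) * ((\<Prod>u\<in>N. sin (\<phi> - \<alpha> u)) * sin \<phi> ^ (d - card N))
    \<le> (sin A * exp ((d * \<psi> - sum \<alpha> N) * cot A))
      * ((sin B ^ card N * exp ((card N * \<psi> - sum \<alpha> N) * cot B))
        * (sin B ^ (d - card N) * exp ((d - card N) * \<psi> * cot B)))"
  proof (intro mult_mono 1 2 3)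
    show "(\<Prod>u\<in>N. sin (\<phi> - \<alpha> u)) * sin \<phi> ^ (d - card N) \<ge> 0" "sin \<phi> ^ (d - card N) \<ge> 0"
      using \<alpha> nonneg nonneg[of 0] \<phi> by (auto intro!: mult_nonneg_nonneg prod_nonneg)
  qed (use sA sB in auto)
  also have "\<dots> = sin A * (sin B ^ card N * sin B ^ (d - card N))
      * exp ((d * \<psi> - sum \<alpha> N) * cot A
        + ((card N * \<psi> - sum \<alpha> N) * cot B + (d - card N) * \<psi> * cot B))"
    by (simp only: exp_add mult.assoc mult.commute mult.left_commute)
  also have "\<dots> = sin A * sin B ^ d * exp ((d * \<psi> - sum \<alpha> N) * cot A
        + ((card N * \<psi> - sum \<alpha> N) * cot B + (d - card N) * \<psi> * cot B))"
    using N by (simp add: power_add[symmetric])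
  also have "\<dots> \<le> sin A * sin B ^ d * 1"
    using exponent sA sB by (intro mult_left_mono) auto
  finally show ?thesis
    by simp
qed

section \<open>The invariant region\<close>

text \<open>The set of all \<open>1 + R\<close> with \<open>arg R \<in> [0, \<phi>]\<close> and \<open>arg (1 + R) \<in> [0, \<phi>/d]\<close>: the last condition says
  that \<open>1 + R\<close> lies on the clockwise side of the line through \<open>1\<close> in direction \<open>\<phi>\<close>.\<close>

definition ratio_region :: "complex set" where
  "ratio_region = {rcis \<rho> \<alpha> | \<rho> \<alpha>. 0 < \<rho> \<and> 0 \<le> \<alpha> \<and> \<alpha> \<le> \<phi> / d \<and> sin \<phi> \<le> \<rho> * sin (\<phi> - \<alpha>)}"

text \<open>The last hypothesis says that the point \<open>1 + rcis s \<theta>\<close> does not lie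
  on the counterclockwise side of the line through \<open>0\<close> in direction
  \<open>\<phi> / d\<close>.\<close>

lemma one_add_rcis_in_ratio_region:
  assumes s: "s \<ge> 0" and \<theta>: "0 \<le> \<theta>" "\<theta> \<le> \<phi>" and le: "s * sin (\<theta> - \<phi> / d) \<le> sin (\<phi> / d)"
  shows "1 + rcis s \<theta> \<in> ratio_region"
proof -
  define w where "w = 1 + rcis s \<theta>"
  define \<alpha> where "\<alpha> = Arg w"
  have w: "w = rcis (norm w) \<alpha>"
    using rcis_cmod_Arg[of w] by (simp add: \<alpha>_def)
  \<comment> \<open>Both sides are the imaginary part of \<open>cis \<beta> * cnj w\<close>. Below,
    \<beta> = \<phi> gives the last condition of the region, and \<beta> = \<open>\<phi> / d\<close>
    the bound on the argument.\<close>
  have rotate: "norm w * sin (\<beta> - \<alpha>) = sin \<beta> + s * sin (\<beta> - \<theta>)" for \<beta>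
  proof -
    have "Re w = norm w * cos \<alpha>" "Im w = norm w * sin \<alpha>"
      by (metis Re_rcis w, metis Im_rcis w)
    then have "norm w * cos \<alpha> = 1 + s * cos \<theta>" "norm w * sin \<alpha> = s * sin \<theta>"
      by (simp_all add: w_def)
    moreover have "norm w * sin (\<beta> - \<alpha>) = sin \<beta> * (norm w * cos \<alpha>) - cos \<beta> * (norm w * sin \<alpha>)"
      by (simp add: sin_diff algebra_simps)
    ultimately show ?thesis
      by (simp add: sin_diff algebra_simps)
  qed
  have \<theta>\<phi>: "sin (\<phi> - \<theta>) \<ge> 0" "sin \<theta> \<ge> 0" "sin \<phi> > 0"
    using \<theta> \<phi> by (auto intro!: sin_ge_zero sin_gt_zero)
  have low: "sin \<phi> \<le> norm w * sin (\<phi> - \<alpha>)"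
    using rotate[of \<phi>] s \<theta>\<phi> by simp
  with \<theta>\<phi> have pos: "norm w > 0"
    by (cases "w = 0") auto
  have "Im w \<ge> 0"
    using s \<theta>\<phi> by (simp add: w_def)
  then have \<alpha>0: "\<alpha> \<ge> 0"
    by (simp add: \<alpha>_def Arg_less_0)
  have \<alpha>pi: "\<alpha> \<le> pi"
    by (simp add: \<alpha>_def Arg_le_pi)
  have d': "0 < \<phi> / d" "\<phi> / d < \<phi>"
    using d \<phi> by (simp_all add: field_simps)
  have "s * sin (\<phi> / d - \<theta>) = - (s * sin (\<theta> - \<phi> / d))"
    by (metis minus_diff_eq mult_minus_right sin_minus)
  with rotate[of "\<phi> / d"] le have "norm w * sin (\<phi> / d - \<alpha>) \<ge> 0"
    by simp
  then have ge: "sin (\<phi> / d - \<alpha>) \<ge> 0"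
    using pos by (simp add: zero_le_mult_iff)
  have "\<alpha> \<le> \<phi> / d"
  proof (rule ccontr)
    assume "\<not> \<alpha> \<le> \<phi> / d"
    then have "sin (\<alpha> - \<phi> / d) > 0"
      using \<alpha>pi d' by (intro sin_gt_zero) auto
    then show False
      using ge by (metis minus_diff_eq neg_0_le_iff_le not_le sin_minus)
  qed
  with \<alpha>0 low pos w show ?thesis
    unfolding ratio_region_def w_def[symmetric] by blast
qed

lemma ratio_region_polar:
  assumes "\<And>u. u \<in> N \<Longrightarrow> w u \<in> ratio_region"
  obtains \<rho> \<alpha> where "\<And>u. u \<in> N \<Longrightarrow> w u = rcis (\<rho> u) (\<alpha> u) \<and> 0 < \<rho> u \<and> 0 \<le> \<alpha> u \<and> \<alpha> u \<le> \<phi> / d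
      \<and> sin \<phi> \<le> \<rho> u * sin (\<phi> - \<alpha> u)"
proof -
  have "\<forall>u\<in>N. \<exists>p. w u = rcis (fst p) (snd p) \<and> 0 < fst p \<and> 0 \<le> snd p \<and> snd p \<le> \<phi> / d
      \<and> sin \<phi> \<le> fst p * sin (\<phi> - snd p)"
    using assms unfolding ratio_region_def by fastforce
  then obtain p where "\<forall>u\<in>N. w u = rcis (fst (p u)) (snd (p u)) \<and> 0 < fst (p u) \<and> 0 \<le> snd (p u)
      \<and> snd (p u) \<le> \<phi> / d \<and> sin \<phi> \<le> fst (p u) * sin (\<phi> - snd (p u))"
    by metis
  then show thesis
    by (intro that[of "fst \<circ> p" "snd \<circ> p"]) auto
qed

text \<open>The quotient has angle \<open>\<phi> - sum \<alpha> N\<close>, which lies between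
  \<open>- \<phi> / d\<close> and \<phi>, hence strictly between \<open>- pi\<close> and
  \<open>pi\<close>. So it is not on the negative real axis.\<close>

lemma rcis_div_prod_ne_minus_one:
  assumes r: "r \<ge> 0" and N: "finite N" "card N \<le> d + 1"
    and w: "\<And>u. u \<in> N \<Longrightarrow> w u \<in> ratio_region"
  shows "1 + rcis r \<phi> / prod w N \<noteq> 0"
proof -
  obtain \<rho> \<alpha> where polar: "\<And>u. u \<in> N \<Longrightarrow> w u = rcis (\<rho> u) (\<alpha> u) \<and> 0 < \<rho> u \<and> 0 \<le> \<alpha> u \<and> \<alpha> u \<le> \<phi> / d
      \<and> sin \<phi> \<le> \<rho> u * sin (\<phi> - \<alpha> u)"
    using ratio_region_polar[of N w] w by blast
  define s \<theta> where "s = r / prod \<rho> N" and "\<theta> = \<phi> - sum \<alpha> N"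
  have eq: "rcis r \<phi> / prod w N = rcis s \<theta>"
    using polar N by (simp add: prod_rcis[symmetric] rcis_divide[symmetric] s_def \<theta>_def)
  have s: "s \<ge> 0"
    unfolding s_def using r polar by (intro divide_nonneg_nonneg prod_nonneg) (auto intro: less_imp_le)
  have "sum \<alpha> N \<le> card N * (\<phi> / d)"
    using polar sum_bounded_above[of N \<alpha> "\<phi> / d"] by simp
  also have "\<dots> \<le> (d + 1) * (\<phi> / d)"
    using N \<phi> by (intro mult_right_mono) (auto simp del: of_nat_add of_nat_Suc)
  also have "\<dots> = \<phi> + \<phi> / d"
    using d by (simp add: field_simps)
  finally have "\<theta> \<ge> - (\<phi> / d)"
    by (simp add: \<theta>_def)
  moreover have "\<phi> / d < \<phi>"
    using d \<phi> by (simp add: field_simps)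
  moreover have "\<theta> \<le> \<phi>"
    using polar by (simp add: \<theta>_def sum_nonneg)
  ultimately have \<theta>: "- pi < \<theta>" "\<theta> < pi"
    using \<phi> by auto
  show ?thesis
  proof
    assume "1 + rcis r \<phi> / prod w N = 0"
    then have "Re (1 + rcis s \<theta>) = 0" "Im (1 + rcis s \<theta>) = 0"
      by (simp_all add: eq)
    then have "1 + s * cos \<theta> = 0" and im: "s * sin \<theta> = 0"
      by simp_all
    then have "s \<noteq> 0"
      by auto
    with im \<theta> have "\<theta> = 0"
      using sin_eq_0_pi by auto
    with \<open>1 + s * cos \<theta> = 0\<close> s show False
      by simp
  qed
qed

text \<open>Membership of each \<open>w u\<close> gives
  \<open>1 / \<rho> u \<le> sin (\<phi> - \<alpha> u) / sin \<phi>\<close>. This bounds the modulus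
  \<open>s\<close> of the quotient and reduces the claim to
  \<open>sin_mult_prod_sin_le\<close>.\<close>

lemma ratio_region_step:
  assumes r: "r \<ge> 0"
    and bound: "r < sin (\<phi> / real d) * sin \<phi> ^ d /
      (sin ((real d - 1) * \<phi> / real d - real d * psi_star d \<phi>) * sin (\<phi> - psi_star d \<phi>) ^ d)"
    and N: "finite N" "card N \<le> d"
    and w: "\<And>u. u \<in> N \<Longrightarrow> w u \<in> ratio_region"
  shows "1 + rcis r \<phi> / prod w N \<in> ratio_region"
proof -
  define A where "A = (real d - 1) * \<phi> / real d - real d * psi_star d \<phi>"
  define B where "B = \<phi> - psi_star d \<phi>"
  note ang = psi_star_angles[folded A_def B_def]
  have sA: "sin A > 0" and sB: "sin B > 0" and s\<phi>: "sin \<phi> > 0"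
    using ang \<phi> by (simp_all add: sin_gt_zero)
  obtain \<rho> \<alpha> where polar: "\<And>u. u \<in> N \<Longrightarrow> w u = rcis (\<rho> u) (\<alpha> u) \<and> 0 < \<rho> u \<and> 0 \<le> \<alpha> u \<and> \<alpha> u \<le> \<phi> / d
      \<and> sin \<phi> \<le> \<rho> u * sin (\<phi> - \<alpha> u)"
    using ratio_region_polar[of N w] w by blast
  define s \<theta> where "s = r / prod \<rho> N" and "\<theta> = \<phi> - sum \<alpha> N"
  have eq: "rcis r \<phi> / prod w N = rcis s \<theta>"
    using polar N by (simp add: prod_rcis[symmetric] rcis_divide[symmetric] s_def \<theta>_def)
  have \<rho>: "prod \<rho> N > 0"
    using polar by (simp add: prod_pos)
  have s: "s \<ge> 0"
    using r \<rho> by (simp add: s_def)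
  have d': "0 < \<phi> / d" "\<phi> / d < \<phi>"
    using d \<phi> by (simp_all add: field_simps)
  have "sum \<alpha> N \<le> card N * (\<phi> / d)"
    using polar sum_bounded_above[of N \<alpha> "\<phi> / d"] by simp
  also have "\<dots> \<le> d * (\<phi> / d)"
    using N \<phi> by (intro mult_right_mono) auto
  also have "\<dots> = \<phi>"
    using d by simp
  finally have \<theta>: "0 \<le> \<theta>" "\<theta> \<le> \<phi>"
    using polar by (simp_all add: \<theta>_def sum_nonneg)
  have "s * sin (\<theta> - \<phi> / d) \<le> sin (\<phi> / d)"
  \<comment> \<open>In the first case the left side is not positive; only the second uses the bound
    on \<open>r\<close>.\<close>
  proof (cases "\<theta> \<le> \<phi> / d")
    case True
    then have "sin (\<phi> / d - \<theta>) \<ge> 0"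
      using \<theta> d' \<phi> by (intro sin_ge_zero) auto
    then have "sin (\<theta> - \<phi> / d) \<le> 0"
      by (metis minus_diff_eq neg_le_0_iff_le sin_minus)
    then have "s * sin (\<theta> - \<phi> / d) \<le> 0"
      using s by (simp add: mult_nonneg_nonpos)
    also have "0 \<le> sin (\<phi> / d)"
      using d' \<phi> by (intro sin_ge_zero) auto
    finally show ?thesis .
  next
    case False
    then have small: "sum \<alpha> N < \<phi> - \<phi> / d"
      by (simp add: \<theta>_def)
    define P where "P = (\<Prod>u\<in>N. sin (\<phi> - \<alpha> u))"
    have "sin \<phi> ^ card N = (\<Prod>u\<in>N. sin \<phi>)"
      by simp
    also have "\<dots> \<le> (\<Prod>u\<in>N. \<rho> u * sin (\<phi> - \<alpha> u))"
      using polar s\<phi> by (intro prod_mono) auto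
    also have "\<dots> = prod \<rho> N * P"
      by (simp add: prod.distrib P_def)
    finally have "sin \<phi> ^ card N * sin \<phi> ^ (d - card N) \<le> (prod \<rho> N * P) * sin \<phi> ^ (d - card N)"
      using s\<phi> by (intro mult_right_mono) auto
    then have le1: "sin \<phi> ^ d \<le> prod \<rho> N * (P * sin \<phi> ^ (d - card N))"
      using N by (simp add: power_add[symmetric] mult.assoc)
    have "\<theta> - \<phi> / d > 0" "\<theta> - \<phi> / d < pi"
      using False \<theta> d' \<phi> by linarith+
    then have s\<theta>: "sin (\<theta> - \<phi> / d) > 0"
      by (rule sin_gt_zero)
    have le2: "sin (\<theta> - \<phi> / d) * (P * sin \<phi> ^ (d - card N)) \<le> sin A * sin B ^ d"
      unfolding A_def B_def \<theta>_def P_def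
      by (rule sin_mult_prod_sin_le[OF N(2) _ small]) (use polar d' in fastforce)
    have rb: "r * (sin A * sin B ^ d) \<le> sin (\<phi> / d) * sin \<phi> ^ d"
      using bound[folded A_def B_def] sA sB by (simp add: pos_less_divide_eq less_imp_le)
    \<comment> \<open>The goal is multiplied by \<open>sin \<phi> ^ d\<close>, so that
      \<open>le1\<close> brings in \<open>prod \<rho> N\<close>, which cancels the denominator of
      \<open>s\<close>.\<close>
    have "(s * sin (\<theta> - \<phi> / d)) * sin \<phi> ^ d
        \<le> (s * sin (\<theta> - \<phi> / d)) * (prod \<rho> N * (P * sin \<phi> ^ (d - card N)))"
      using le1 s s\<theta> by (intro mult_left_mono) auto
    also have "\<dots> = r * (sin (\<theta> - \<phi> / d) * (P * sin \<phi> ^ (d - card N)))"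
      using \<rho> by (simp add: s_def)
    also have "\<dots> \<le> r * (sin A * sin B ^ d)"
      using le2 r by (rule mult_left_mono)
    also note rb
    finally show ?thesis
      using s\<phi> by simp
  qed
  from one_add_rcis_in_ratio_region[OF s \<theta> this] show ?thesis
    by (simp add: eq)
qed

end

section \<open>The recursion for the independence polynomial\<close>

text \<open>This is the independence polynomial of the subgraph induced on \<open>S\<close>. With
  the relation \<open>E\<close> fixed, deleting vertices only means shrinking
  \<open>S\<close>.\<close>

definition indep_sum :: "('a \<Rightarrow> 'a \<Rightarrow> bool) \<Rightarrow> 'b::comm_semiring_1 \<Rightarrow> 'a set \<Rightarrow> 'b" where
  "indep_sum E z S = (\<Sum>I | I \<subseteq> S \<and> (\<forall>u\<in>I. \<forall>v\<in>I. \<not> E u v). z ^ card I)"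

lemma indep_sum_empty [simp]: "indep_sum E z {} = 1"
proof -
  have "{I. I \<subseteq> {} \<and> (\<forall>u\<in>I. \<forall>v\<in>I. \<not> E u v)} = {{}}"
    by auto
  then show ?thesis
    by (simp add: indep_sum_def)
qed

text \<open>Independent sets are split by whether they contain \<open>v\<close>; those that do arise
  by adding \<open>v\<close> to an independent set that avoids its neighbours.\<close>

lemma indep_sum_insert:
  assumes S: "finite S" "v \<notin> S" and irrefl: "\<not> E v v" and sym: "\<And>u. E u v \<longleftrightarrow> E v u"
  shows "indep_sum E z (insert v S) = indep_sum E z S + z * indep_sum E z (S - {u. E v u})"
proof -
  let ?ind = "\<lambda>S. {I. I \<subseteq> S \<and> (\<forall>u\<in>I. \<forall>v\<in>I. \<not> E u v)}"
  let ?T = "S - {u. E v u}"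
  have fin: "finite (?ind S)" "finite (?ind ?T)"
    using S by (auto intro: finite_subset[of _ "Pow S"])
  have "?ind (insert v S) = ?ind S \<union> insert v ` ?ind ?T"
  proof (intro equalityI subsetI)
    fix I
    assume I: "I \<in> ?ind (insert v S)"
    show "I \<in> ?ind S \<union> insert v ` ?ind ?T"
    proof (cases "v \<in> I")
      case True
      with I have "I - {v} \<in> ?ind ?T"
        by blast
      moreover have "I = insert v (I - {v})"
        using True by auto
      ultimately show ?thesis
        by blast
    qed (use I in blast)
  next
    fix I
    assume "I \<in> ?ind S \<union> insert v ` ?ind ?T"
    then show "I \<in> ?ind (insert v S)"
      using irrefl sym by blast
  qed
  moreover have "?ind S \<inter> insert v ` ?ind ?T = {}"
    using S by auto
  moreover have "inj_on (insert v) (?ind ?T)"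
    using S by (intro inj_on_inverseI[where g = "\<lambda>I. I - {v}"]) auto
  moreover have "z ^ card (insert v I) = z * z ^ card I" if "I \<in> ?ind ?T" for I
  proof -
    have "finite I" "v \<notin> I"
      using that S by (auto intro: finite_subset)
    then show ?thesis
      by simp
  qed
  ultimately show ?thesis
    using fin by (simp add: indep_sum_def sum.union_disjoint sum.reindex sum_distrib_left)
qed

text \<open>The elements of \<open>N\<close> are added to \<open>T\<close> one at a time, and the
  successive quotients of \<open>Z\<close> multiply up. Letting \<open>M\<close> range over all
  subsets makes the hypothesis pass to smaller \<open>N\<close>.\<close>

lemma telescope_prod:
  fixes Z :: "'a set \<Rightarrow> 'b::field"
  assumes "finite N"
    and "\<And>u M. u \<in> N \<Longrightarrow> M \<subseteq> N - {u} \<Longrightarrow> Z (T \<union> M) \<noteq> 0 \<and> Z (insert u (T \<union> M)) / Z (T \<union> M) \<in> W"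
  shows "\<exists>w. (\<forall>u\<in>N. w u \<in> W) \<and> Z (T \<union> N) = Z T * prod w N"
  using assms
proof (induction N rule: finite_induct)
  case empty
  then show ?case
    by simp
next
  case (insert x N)
  have "\<exists>w. (\<forall>u\<in>N. w u \<in> W) \<and> Z (T \<union> N) = Z T * prod w N"
  proof (rule insert.IH)
    fix u M
    assume "u \<in> N" "M \<subseteq> N - {u}"
    then show "Z (T \<union> M) \<noteq> 0 \<and> Z (Set.insert u (T \<union> M)) / Z (T \<union> M) \<in> W"
      by (intro insert.prems) auto
  qed
  then obtain w where w: "\<forall>u\<in>N. w u \<in> W" "Z (T \<union> N) = Z T * prod w N"
    by blast
  have x: "Z (T \<union> N) \<noteq> 0" "Z (Set.insert x (T \<union> N)) / Z (T \<union> N) \<in> W"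
    using insert.prems[of x N] insert.hyps by auto
  let ?w = "w(x := Z (Set.insert x (T \<union> N)) / Z (T \<union> N))"
  have "prod ?w N = prod w N"
    using insert.hyps by (intro prod.cong) auto
  then have "Z (T \<union> Set.insert x N) = Z T * prod ?w (Set.insert x N)"
    using insert.hyps w x by (simp add: field_simps)
  moreover have "\<forall>u\<in>Set.insert x N. ?w u \<in> W"
    using w x by auto
  ultimately show ?case
    by blast
qed

lemma indep_sum_nonzero:
  fixes E :: "'a \<Rightarrow> 'a \<Rightarrow> bool" and z :: complex
  assumes V: "finite V"
    and irrefl: "\<And>u. \<not> E u u" and sym: "\<And>u v. E u v \<longleftrightarrow> E v u"
    and deg: "\<And>v. v \<in> V \<Longrightarrow> card (V \<inter> {u. E v u}) \<le> d + 1"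
    and step: "\<And>(N::'a set) w. finite N \<Longrightarrow> card N \<le> d \<Longrightarrow> (\<And>u. u \<in> N \<Longrightarrow> w u \<in> W)
      \<Longrightarrow> 1 + z / prod w N \<in> W"
    and root: "\<And>(N::'a set) w. finite N \<Longrightarrow> card N \<le> d + 1 \<Longrightarrow> (\<And>u. u \<in> N \<Longrightarrow> w u \<in> W)
      \<Longrightarrow> 1 + z / prod w N \<noteq> 0"
  shows "indep_sum E z V \<noteq> 0"
proof -
  let ?Z = "indep_sum E z" and ?N = "\<lambda>v. {u. E v u}"
  \<comment> \<open>Strong induction on \<open>S\<close> needs both parts together: the quotients,
    which are the values \<open>1 + R\<close>, make sense only where \<open>?Z\<close> does not
    vanish.\<close>
  have "?Z S \<noteq> 0 \<and> (\<forall>v\<in>V - S. card (S \<inter> ?N v) \<le> d \<longrightarrow> ?Z (insert v S) / ?Z S \<in> W)"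
    if "S \<subseteq> V" for S
    using finite_subset[OF that V] that
  proof (induction S rule: finite_psubset_induct)
    case (psubset S)
    note IH = psubset.IH[OF _ order_trans[OF psubset_imp_subset psubset.prems]]
    \<comment> \<open>This is used twice: with \<open>T = S - {v}\<close> to show that
      \<open>?Z S\<close> does not vanish, and with \<open>T = S\<close> for the quotient.\<close>
    have ratio: "\<exists>w. (\<forall>u\<in>T \<inter> ?N v. w u \<in> W) \<and> ?Z (insert v T) / ?Z T = 1 + z / prod w (T \<inter> ?N v)"
      if T: "T \<subseteq> S" "?Z T \<noteq> 0" and v: "v \<in> V - T" for T v
    proof -
      have finT: "finite T"
        using T psubset.hyps finite_subset by blast
      let ?T = "T - ?N v"
      have "\<exists>w. (\<forall>u\<in>T \<inter> ?N v. w u \<in> W) \<and> ?Z (?T \<union> (T \<inter> ?N v)) = ?Z ?T * prod w (T \<inter> ?N v)"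
      proof (rule telescope_prod)
        fix u M
        assume u: "u \<in> T \<inter> ?N v" and M: "M \<subseteq> T \<inter> ?N v - {u}"
        let ?U = "?T \<union> M"
        have U: "?U \<subset> S" "u \<in> V - ?U" "v \<notin> ?U" "v \<in> V" "E u v"
          using u M T v psubset.prems sym by auto
        \<comment> \<open>The vertex \<open>v\<close> is a neighbour of \<open>u\<close> outside
          \<open>?U\<close>, so at most \<open>d\<close> of the \<open>d + 1\<close> possible
          neighbours remain in \<open>?U\<close>.\<close>
        then have "insert v (?U \<inter> ?N u) \<subseteq> V \<inter> ?N u"
          using psubset.prems by auto
        then have "card (insert v (?U \<inter> ?N u)) \<le> d + 1"
          using V deg[of u] U card_mono by (meson DiffD1 finite_Int le_trans)
        moreover have "finite ?U"
          using U(1) psubset.hyps by (meson finite_subset psubset_imp_subset)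
        ultimately have "card (?U \<inter> ?N u) \<le> d"
          using U by simp
        then show "?Z ?U \<noteq> 0 \<and> ?Z (insert u ?U) / ?Z ?U \<in> W"
          using IH[OF U(1) U(1)] U(2) by blast
      qed (use finT in simp)
      then obtain w where w: "\<forall>u\<in>T \<inter> ?N v. w u \<in> W" "?Z T = ?Z ?T * prod w (T \<inter> ?N v)"
        by (metis Int_Diff_Un Un_commute)
      have "?Z (insert v T) = ?Z T + z * ?Z ?T"
        using v finT by (intro indep_sum_insert irrefl sym) auto
      then have "?Z (insert v T) / ?Z T = 1 + z * ?Z ?T / ?Z T"
        using T by (simp add: field_simps)
      also have "\<dots> = 1 + z / prod w (T \<inter> ?N v)"
        using w T by simp
      finally show ?thesis
        using w by blast
    qed
    have nz: "?Z S \<noteq> 0"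
    proof (cases "S = {}")
      case False
      then obtain v where v: "v \<in> S"
        by blast
      let ?S = "S - {v}"
      have S: "?S \<subset> S" "v \<in> V - ?S" "insert v ?S = S"
        using v psubset.prems by auto
      have nz': "?Z ?S \<noteq> 0"
        using IH[OF S(1) S(1)] by (rule conjunct1)
      obtain w where w: "\<forall>u\<in>?S \<inter> ?N v. w u \<in> W" "?Z S / ?Z ?S = 1 + z / prod w (?S \<inter> ?N v)"
        using ratio[OF psubset_imp_subset[OF S(1)] nz' S(2)] unfolding S(3) by (elim exE conjE)
      have "card (?S \<inter> ?N v) \<le> card (V \<inter> ?N v)"
        using psubset.prems V by (intro card_mono) auto
      then have "card (?S \<inter> ?N v) \<le> d + 1"
        using deg[of v] S by simp
      \<comment> \<open>Here \<open>v\<close> may have all \<open>d + 1\<close> neighbours in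
        \<open>?S\<close>, so \<open>root\<close> is applied instead of \<open>step\<close>.\<close>
      then have "?Z S / ?Z ?S \<noteq> 0"
        unfolding w(2) using w(1) psubset.hyps by (intro root) auto
      then show ?thesis
        by auto
    qed simp
    moreover have "?Z (insert v S) / ?Z S \<in> W" if v: "v \<in> V - S" and "card (S \<inter> ?N v) \<le> d" for v
    proof -
      obtain w where w: "\<forall>u\<in>S \<inter> ?N v. w u \<in> W" "?Z (insert v S) / ?Z S = 1 + z / prod w (S \<inter> ?N v)"
        using ratio[OF order_refl nz v] by blast
      show ?thesis
        unfolding w(2) using w(1) that psubset.hyps by (intro step) auto
    qed
    ultimately show ?case
      by blast
  qed
  then show ?thesis
    by blast
qed

section \<open>Application to graphs of bounded degree\<close>

lemma (in fin_digraph) card_neighbours_le_max_degree: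
  assumes "v \<in> verts G"
  shows "card (verts G \<inter> {u. v \<rightarrow> u}) \<le> max_degree G"
proof -
  have "verts G \<inter> {u. v \<rightarrow> u} \<subseteq> head G ` out_arcs G v"
    by (auto simp: arcs_ends_def arc_to_ends_def)
  then have "card (verts G \<inter> {u. v \<rightarrow> u}) \<le> out_degree G v"
    unfolding out_degree_def using finite_out_arcs
    by (meson card_image_le card_mono finite_imageI le_trans)
  also have "\<dots> \<le> max_degree G"
    unfolding max_degree_def using assms by (intro Max_ge) auto
  finally show ?thesis .
qed

theorem theorem7p1:
  fixes d :: nat and r \<phi> :: real and l :: complex and G :: "('a, 'b) pre_digraph"
  assumes "d \<ge> 2"
    and "l = complex_of_real r * exp (\<i> * complex_of_real \<phi>)"
    and "r \<ge> 0"
    and "\<phi> \<in> {pi / 2..<pi}"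
    and "r < sin (\<phi> / real d) * sin \<phi> ^ d /
      (sin ((real d - 1) * \<phi> / real d - real d * psi_star d \<phi>) * sin (\<phi> - psi_star d \<phi>) ^ d)"
    and "graph G"
    and "max_degree G \<le> d + 1"
  shows "independence_poly G l \<noteq> 0"
proof -
  interpret graph G
    by fact
  have \<phi>: "0 < \<phi>" "\<phi> < pi"
    using assms(4) pi_gt_zero by (auto intro: less_le_trans[of 0 "pi / 2"])
  have l: "l = rcis r \<phi>"
    by (simp add: assms(2) rcis_def cis_conv_exp)
  have "indep_sum (\<lambda>u v. u \<rightarrow>\<^bsub>G\<^esub> v) l (verts G) \<noteq> 0"
  proof (rule indep_sum_nonzero[where d = d and W = "ratio_region d \<phi>"])
    fix N :: "'a set" and w
    assume N: "finite N" and w: "\<And>u. u \<in> N \<Longrightarrow> w u \<in> ratio_region d \<phi>"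
    show "1 + l / prod w N \<in> ratio_region d \<phi>" if "card N \<le> d"
      unfolding l using ratio_region_step[OF assms(1) \<phi> assms(3,5) N that] w by blast
    show "1 + l / prod w N \<noteq> 0" if "card N \<le> d + 1"
      unfolding l using rcis_div_prod_ne_minus_one[OF assms(1) \<phi> assms(3) N that] w by blast
  next
    show "\<not> u \<rightarrow>\<^bsub>G\<^esub> u" for u
      using adj_not_same by blast
    show "u \<rightarrow>\<^bsub>G\<^esub> v \<longleftrightarrow> v \<rightarrow>\<^bsub>G\<^esub> u" for u v
      using arcs_ends_symmetric[OF sym_arcs] by blast
    show "card (verts G \<inter> {u. v \<rightarrow>\<^bsub>G\<^esub> u}) \<le> d + 1" if "v \<in> verts G" for v
      using card_neighbours_le_max_degree[OF that] assms(7) by simp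
  qed simp
  then show ?thesis
    by (simp add: independence_poly_def indep_sum_def independent_set_def)
qed

end
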